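(* Let $\chi$ be a probability distribution on $\mathbb{N}_0$ with $0<\chi(0)<1$ and probability generating function $G$, and let $k\in\mathbb{N}$. Consider the $k$-jump normal game on the Galton-Watson tree $\mathcal{T}_\chi$ with offspring distribution $\chi$, started at the root. Define $H_k:[0,c_{k-1}]\to[0,1]$ by $$H_k(x)=G\big(g_k(F_0(x),F_1(x),\ldots,F_k(x))\big).$$ Then the probability $n\ell_k$ that the first player loses is the minimum positive fixed point of $H_k$. Moreover, the probability that the first player wins is $nw_k=1-F_k(n\ell_k)$.
   Context: $\mathbb{N}=\{1,2,\dots\}$, $\mathbb{N}_0=\mathbb{N}\cup\{0\}$. $G(x)=\sum_{m\ge 0}\chi(m)x^m$ on $[0,1]$. Game. $\mathcal{T}_\chi$ is the rooted Galton-Watson tree in which every vertex independently has a number of children distributed as $\chi$. For a vertex $u$, $\Gamma_i(u)$ is the set of descendants $v\neq u$ of $u$ at graph distance at most $i$ from $u$. In the $k$-jump normal game a token starts at a vertex; two players P1, P2 alternate (P1 first), and a move relocates the token from its current vertex $u$ to any vertex of $\Gamma_k(u)$. A player unable to move loses. The tree is fully known to both players and both play optimally; a game that goes on forever is a draw. $n\ell_k$ and $nw_k$ are the probabilities (over the random tree) that P1 loses, respectively wins, the $k$-jump normal game started at the root of $\mathcal{T}_\chi$. Functions $F_i$ and numbers $c_i$. $F_0(x)=1$ on $[0,1]$, $c_0=1$, and recursively for $i\in\mathbb{N}$, $F_i:[0,c_{i-1}]\to[0,1]$, $F_i(x)=G(F_{i-1}(x)-x)$, where $c_i$ is the unique fixed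 point of $F_i$ (it is known that $c_i$ exists, is unique, and $c_i<c_{i-1}$). Functions $g_i$. $g_1(x,y)=x-y$ on $\mathbb{R}^2$, and for $i\ge2$, $$g_i(x_0,x_1,\ldots,x_i)=G(g_{i-1}(x_0,x_2,\ldots,x_i))-G(g_{i-1}(x_1,x_2,\ldots,x_i)),$$ defined on the set $\mathcal{D}_i$ of all $(x_0,\ldots,x_i)$ for which $g_{i-1}(x_0,x_2,\ldots,x_i)$ and $g_{i-1}(x_1,x_2,\ldots,x_i)$ are defined and lie in $[0,1]$. *)

theory Defs
  imports "HOL-Probability.Probability" "HOL-Library.Sublist" "HOL-Library.Extended_Nat"
begin

section \<open>Games of perfect information\<close>

text \<open>
  A game is given by the map \<open>M\<close> sending each position to the set of positions to which the
  token may be moved. Moves are numbered from 0 and player \<open>P1\<close> makes move 0.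
\<close>

datatype player = P1 | P2

definition mover :: "nat \<Rightarrow> player" where
  "mover i = (if even i then P1 else P2)"

text \<open>
  A complete play consisting of \<open>n\<close> moves, where \<open>n = \<infinity>\<close> is allowed. Only the positions \<open>x i\<close>
  with \<open>i \<le> n\<close> are relevant. A finite play ends only where there is no legal move.
\<close>

definition complete_play :: "('v \<Rightarrow> 'v set) \<Rightarrow> 'v \<Rightarrow> enat \<Rightarrow> (nat \<Rightarrow> 'v) \<Rightarrow> bool" where
  "complete_play M v n x \<longleftrightarrow>
     x 0 = v \<and>
     (\<forall>i. enat i < n \<longrightarrow> x (Suc i) \<in> M (x i)) \<and>
     (\<forall>m. n = enat m \<longrightarrow> M (x m) = {})"

text \<open>
  A strategy chooses a legal move, whenever there is one, from the non-empty list of all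
  positions visited so far.
\<close>

definition is_strategy :: "('v \<Rightarrow> 'v set) \<Rightarrow> ('v list \<Rightarrow> 'v) \<Rightarrow> bool" where
  "is_strategy M \<sigma> \<longleftrightarrow> (\<forall>h. h \<noteq> [] \<and> M (last h) \<noteq> {} \<longrightarrow> \<sigma> h \<in> M (last h))"

definition follows :: "player \<Rightarrow> ('v list \<Rightarrow> 'v) \<Rightarrow> enat \<Rightarrow> (nat \<Rightarrow> 'v) \<Rightarrow> bool" where
  "follows p \<sigma> n x \<longleftrightarrow>
     (\<forall>i. enat i < n \<and> mover i = p \<longrightarrow> x (Suc i) = \<sigma> (map x [0..<Suc i]))"

text \<open>A finite play is lost by the player who would have to move next.\<close>

definition won_by :: "player \<Rightarrow> enat \<Rightarrow> bool" where
  "won_by p n \<longleftrightarrow> (\<exists>m. n = enat m \<and> mover m \<noteq> p)"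

definition has_winning_strategy :: "('v \<Rightarrow> 'v set) \<Rightarrow> 'v \<Rightarrow> player \<Rightarrow> bool" where
  "has_winning_strategy M v p \<longleftrightarrow>
     (\<exists>\<sigma>. is_strategy M \<sigma> \<and>
       (\<forall>n x. complete_play M v n x \<and> follows p \<sigma> n x \<longrightarrow> won_by p n))"


section \<open>The \<open>k\<close>-jump normal game on a Galton-Watson tree\<close>

text \<open>
  Ulam-Harris encoding: the root is \<open>[]\<close> and the children of \<open>u\<close> are \<open>u @ [j]\<close> for
  \<open>j < N u\<close>. The values of \<open>N\<close> at lists outside the tree play no role.
\<close>

definition tree :: "(nat list \<Rightarrow> nat) \<Rightarrow> nat list set" where
  "tree N = {u. \<forall>j<length u. u ! j < N (take j u)}"

definition galton_watson :: "nat pmf \<Rightarrow> (nat list \<Rightarrow> nat) measure" where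
  "galton_watson chi = (\<Pi>\<^sub>M u\<in>UNIV. measure_pmf chi)"

text \<open>
  The graph distance from a vertex to one of its descendants is the difference of their
  depths, i.e. of the lengths of the lists encoding them.
\<close>

definition \<Gamma> :: "(nat list \<Rightarrow> nat) \<Rightarrow> nat \<Rightarrow> nat list \<Rightarrow> nat list set" where
  "\<Gamma> N i u = {v \<in> tree N. strict_prefix u v \<and> length v - length u \<le> i}"

text \<open>Under optimal play \<open>P1\<close> loses iff \<open>P2\<close> has a winning strategy.\<close>

definition nl :: "nat pmf \<Rightarrow> nat \<Rightarrow> real" where
  "nl chi k = \<P>(N in galton_watson chi. has_winning_strategy (\<Gamma> N k) [] P2)"

definition nw :: "nat pmf \<Rightarrow> nat \<Rightarrow> real" where
  "nw chi k = \<P>(N in galton_watson chi. has_winning_strategy (\<Gamma> N k) [] P1)"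


section \<open>The associated functions\<close>

text \<open>
  All functions below are total; their intended domains are given in the comments, and the
  values elsewhere are irrelevant.
\<close>

text \<open>Intended domain \<open>{0..1}\<close>.\<close>

definition pgf :: "nat pmf \<Rightarrow> real \<Rightarrow> real" where
  "pgf chi x = (\<Sum>m. pmf chi m * x ^ m)"

text \<open>The intended domain of \<open>F_fun chi (Suc i)\<close> is \<open>{0..c_fix chi i}\<close>.\<close>

fun F_fun :: "nat pmf \<Rightarrow> nat \<Rightarrow> real \<Rightarrow> real" where
  "F_fun chi 0 x = 1"
| "F_fun chi (Suc i) x = pgf chi (F_fun chi i x - x)"

fun c_fix :: "nat pmf \<Rightarrow> nat \<Rightarrow> real" where
  "c_fix chi 0 = 1"
| "c_fix chi (Suc i) = (THE x. x \<in> {0..c_fix chi i} \<and> F_fun chi (Suc i) x = x)"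

text \<open>
  \<open>g_fun chi [x\<^sub>0, \<dots>, x\<^sub>i]\<close> is $g_i(x_0,\ldots,x_i)$, so the index \<open>i \<ge> 1\<close> is the length of the
  list minus one; \<open>g_dom\<close> describes the domain of definition.
\<close>

fun g_fun :: "nat pmf \<Rightarrow> real list \<Rightarrow> real" where
  "g_fun chi [x, y] = x - y"
| "g_fun chi (x\<^sub>0 # x\<^sub>1 # x\<^sub>2 # xs) =
     pgf chi (g_fun chi (x\<^sub>0 # x\<^sub>2 # xs)) - pgf chi (g_fun chi (x\<^sub>1 # x\<^sub>2 # xs))"
| "g_fun chi _ = undefined"

fun g_dom :: "nat pmf \<Rightarrow> real list \<Rightarrow> bool" where
  "g_dom chi [x, y] \<longleftrightarrow> True"
| "g_dom chi (x\<^sub>0 # x\<^sub>1 # x\<^sub>2 # xs) \<longleftrightarrow>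
     g_dom chi (x\<^sub>0 # x\<^sub>2 # xs) \<and> g_fun chi (x\<^sub>0 # x\<^sub>2 # xs) \<in> {0..1} \<and>
     g_dom chi (x\<^sub>1 # x\<^sub>2 # xs) \<and> g_fun chi (x\<^sub>1 # x\<^sub>2 # xs) \<in> {0..1}"
| "g_dom chi _ \<longleftrightarrow> False"

definition F_list :: "nat pmf \<Rightarrow> nat \<Rightarrow> real \<Rightarrow> real list" where
  "F_list chi k x = map (\<lambda>i. F_fun chi i x) [0..<Suc k]"

text \<open>Intended domain \<open>{0..c_fix chi (k - 1)}\<close>.\<close>

definition H_fun :: "nat pmf \<Rightarrow> nat \<Rightarrow> real \<Rightarrow> real" where
  "H_fun chi k x = pgf chi (g_fun chi (F_list chi k x))"

definition positive_fixed_points :: "nat pmf \<Rightarrow> nat \<Rightarrow> real set" where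
  "positive_fixed_points chi k = {x \<in> {0..c_fix chi (k - 1)}. 0 < x \<and> H_fun chi k x = x}"

end

theory Submission
  imports Defs
begin

text \<open>
  Let \<open>L\<close> be the class of trees whose root is a losing position, and \<open>l\<close> its probability. All moves
  go downwards, so whether a vertex is losing depends only on the subtree below it. The root is
  winning iff a losing vertex lies within distance \<open>k\<close> below it, and losing iff all vertices within
  distance \<open>k\<close> below it are winning. Given the number of children, their subtrees are independent
  copies of the whole tree, so if \<open>E\<close> has probability \<open>p\<close>, then all children of the root satisfy
  \<open>E\<close> with probability \<open>pgf chi p\<close> (\<open>prob_all_children\<close>).

  There is no losing vertex within distance \<open>i + 1\<close> of the root iff no child is losing or has one
  within distance \<open>i\<close>. A losing child has none within distance \<open>k\<close>, so the probability of
  this condition on a child is a difference of probabilities, and the recursion for $F_i$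
  results (\<open>prob_avoiding\<close>). The case \<open>i = k\<close> gives the formula for \<open>nw\<close>. The root is losing iff
  each child is winning together with all vertices within distance \<open>k - 1\<close> below it. Being
  winning means that the distance to the nearest losing vertex is at most \<open>k\<close>; splitting such events
  as differences and descending one generation at a time produces the recursion for $g_i$
  (\<open>prob_winning_and_avoiding\<close>) and \<open>l = H_fun chi k l\<close>.

  These computations use about \<open>L\<close> only that no losing vertex is reached from a losing one. So
  let \<open>L\<^sub>n\<close> be the class of trees where the loss takes fewer than \<open>n\<close> rounds. The same computations,
  with \<open>L\<^sub>n\<close> for \<open>L\<close>, express the probability of \<open>L\<^sub>n\<^sub>+\<^sub>1\<close> by that of \<open>L\<^sub>n\<close> and
  show that the latter is the \<open>n\<close>-th iterate of \<open>H_fun chi k\<close> at 0. As the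
  trees are locally finite, these probabilities increase to \<open>l\<close>. Hence \<open>l\<close> is the least fixed
  point, provided that \<open>H_fun chi k\<close> is increasing (\<open>H_fun_mono\<close>). For this, note that its arguments
  $F_1(x), \ldots, F_k(x)$ decrease in \<open>x\<close>, while $F_0(x)$ is constant; by convexity of the
  generating function, $g_k$ restricted to decreasing sequences of arguments decreases in all of
  them but the first (\<open>g_fun_tail_antimono\<close>).
\<close>


section \<open>The probability generating function\<close>

lemma pmf_sums_1: "pmf chi sums (1::real)" for chi :: "nat pmf"
proof -
  have "(\<lambda>m. measure (measure_pmf chi) {m}) sums measure (measure_pmf chi) (\<Union>m. {m})"
    by (rule finite_measure.finite_measure_UNION) (auto simp: disjoint_family_on_def)
  then show ?thesis
    using measure_pmf.prob_space[of chi] by (simp add: pmf.rep_eq[symmetric])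
qed

lemma summable_pgf:
  assumes "x \<in> {0..1}"
  shows "summable (\<lambda>m. pmf chi m * x ^ m)"
proof (rule summable_comparison_test')
  show "summable (pmf chi)"
    using pmf_sums_1 by (rule sums_summable)
  show "norm (pmf chi m * x ^ m) \<le> pmf chi m" for m
    using assms by (simp add: abs_mult power_le_one mult_left_le)
qed

lemma pgf_0: "pgf chi 0 = pmf chi 0"
  unfolding pgf_def by (rule powser_zero)

lemma pgf_1: "pgf chi 1 = 1"
  using sums_unique[OF pmf_sums_1[of chi]] by (simp add: pgf_def)

lemma pgf_mono:
  assumes "0 \<le> x" "x \<le> y" "y \<le> 1"
  shows "pgf chi x \<le> pgf chi y"
  unfolding pgf_def
  by (intro suminf_le summable_pgf mult_left_mono power_mono) (use assms in auto)

lemma pgf_bounds: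
  assumes "x \<in> {0..1}"
  shows "pgf chi x \<in> {pmf chi 0..1}"
  using assms pgf_mono[of 0 x chi] pgf_mono[of x 1 chi] by (simp add: pgf_0 pgf_1)

lemma continuous_on_pgf: "continuous_on {0..1} (pgf chi)"
proof (rule uniform_limit_theorem)
  show "uniform_limit {0..1} (\<lambda>n x. \<Sum>m<n. pmf chi m * x ^ m) (pgf chi) sequentially"
    unfolding pgf_def[abs_def]
  proof (rule Weierstrass_m_test)
    show "summable (pmf chi)"
      using pmf_sums_1 by (rule sums_summable)
    show "norm (pmf chi m * x ^ m) \<le> pmf chi m" if "x \<in> {0..1}" for m and x :: real
      using that by (simp add: abs_mult power_le_one mult_left_le)
  qed
qed (auto intro!: continuous_intros always_eventually)

text \<open>
  Convexity and monotonicity at once: an increment of the generating function grows when its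
  starting point moves up and when its step gets longer.
\<close>

lemma pgf_increment_mono:
  assumes "0 \<le> a" "a \<le> b" "0 \<le> d" "d \<le> e" "b + e \<le> 1"
  shows "pgf chi (a + d) - pgf chi a \<le> pgf chi (b + e) - pgf chi b"
proof -
  have pow: "(a + d) ^ m - a ^ m \<le> (b + e) ^ m - b ^ m" for m
  proof -
    have "(a + d) ^ m - a ^ m = d * (\<Sum>i<m. a ^ (m - Suc i) * (a + d) ^ i)"
      by (simp add: power_diff_sumr2)
    also have "\<dots> \<le> e * (\<Sum>i<m. b ^ (m - Suc i) * (b + e) ^ i)"
      by (intro mult_mono sum_mono power_mono sum_nonneg) (use assms in auto)
    also have "\<dots> = (b + e) ^ m - b ^ m"
      by (simp add: power_diff_sumr2)
    finally show ?thesis .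
  qed
  have diff: "pgf chi y - pgf chi x = (\<Sum>m. pmf chi m * (y ^ m - x ^ m))"
       "summable (\<lambda>m. pmf chi m * (y ^ m - x ^ m))"
    if "x \<in> {0..1}" "y \<in> {0..1}" for x y
    unfolding pgf_def using summable_pgf[OF that(1)] summable_pgf[OF that(2)]
    by (simp_all add: suminf_diff summable_diff right_diff_distrib)
  show ?thesis
    using assms by (subst (1 2) diff) (auto intro!: suminf_le diff(2) mult_left_mono pow)
qed


section \<open>The functions $F_i$ and their fixed points\<close>

lemma F_fun_at_0: "F_fun chi i 0 = 1"
  by (induction i) (simp_all add: pgf_1)

text \<open>
  Existence and uniqueness of the fixed points have to be proved together with monotonicity and
  continuity, by induction on \<open>i\<close>. Since \<open>F_fun chi i\<close> is weakly decreasing, \<open>F_fun chi i x - x\<close>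
  is strictly decreasing. It falls from 1 to 0 on \<open>{0..c_fix chi i}\<close>, and so on this interval it
  stays in the domain of the generating function, where \<open>F_fun chi (Suc i)\<close> inherits monotonicity
  and continuity.
\<close>

lemma c_fix_properties:
  "c_fix chi i \<in> {pmf chi 0..1} \<and> F_fun chi i (c_fix chi i) = c_fix chi i \<and>
   continuous_on {0..c_fix chi i} (F_fun chi i) \<and>
   antimono_on {0..c_fix chi i} (F_fun chi i)"
  and c_fix_Suc_le: "c_fix chi (Suc i) \<le> c_fix chi i"
  and antimono_F_fun_Suc: "antimono_on {0..c_fix chi i} (F_fun chi (Suc i))"
proof -
  define inv where "inv i \<longleftrightarrow> c_fix chi i \<in> {pmf chi 0..1} \<and>
      F_fun chi i (c_fix chi i) = c_fix chi i \<and>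
      continuous_on {0..c_fix chi i} (F_fun chi i) \<and>
      antimono_on {0..c_fix chi i} (F_fun chi i)" for i
  have step: "inv (Suc i) \<and> c_fix chi (Suc i) \<le> c_fix chi i \<and>
      antimono_on {0..c_fix chi i} (F_fun chi (Suc i))" if "inv i" for i
  proof -
    define c where "c = c_fix chi i"
    have c: "pmf chi 0 \<le> c" "c \<le> 1" "0 \<le> c" and fix_c: "F_fun chi i c = c"
      and cont: "continuous_on {0..c} (F_fun chi i)"
      and anti: "\<And>x y. \<lbrakk>0 \<le> x; x \<le> y; y \<le> c\<rbrakk> \<Longrightarrow> F_fun chi i y \<le> F_fun chi i x"
      using that order_trans[OF pmf_nonneg[of chi 0]]
      by (auto simp: inv_def c_def monotone_on_def)
    have arg: "F_fun chi i x - x \<in> {0..1}" if "x \<in> {0..c}" for x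
      using that anti[of 0 x] anti[of x c] fix_c c by (auto simp: F_fun_at_0)
    have antiS: "F_fun chi (Suc i) y \<le> F_fun chi (Suc i) x"
      if "0 \<le> x" "x \<le> y" "y \<le> c" for x y
      using that anti[of x y] arg[of x] arg[of y] by (auto intro!: pgf_mono)
    have contS: "continuous_on {0..c} (F_fun chi (Suc i))"
      unfolding F_fun.simps
      by (intro continuous_on_compose2[OF continuous_on_pgf] continuous_intros cont)
         (use arg in auto)
    \<comment> \<open>At \<open>c\<close> the function \<open>F_fun chi (Suc i)\<close> takes its smallest value \<open>pgf chi 0 = pmf chi 0\<close>, and
      \<open>c\<close>, being itself a value of the generating function or 1, is not below that.\<close>
    have "\<exists>x\<ge>0. x \<le> c \<and> F_fun chi (Suc i) x - x = 0"
    proof (rule IVT2')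
      show "F_fun chi (Suc i) c - c \<le> 0"
        using c by (simp add: fix_c pgf_0)
      show "0 \<le> F_fun chi (Suc i) 0 - 0"
        by (simp add: F_fun_at_0 pgf_1)
    qed (use c in \<open>auto intro!: continuous_intros contS simp del: F_fun.simps\<close>)
    then obtain d where d: "0 \<le> d" "d \<le> c" "F_fun chi (Suc i) d = d"
      by auto
    have uniq: "x = d" if "x \<in> {0..c}" "F_fun chi (Suc i) x = x" for x
      using that d antiS[of x d] antiS[of d x] by (cases "x \<le> d") auto
    have c_Suc: "c_fix chi (Suc i) = d"
      unfolding c_fix.simps(2) c_def[symmetric]
    proof (rule the_equality)
      show "d \<in> {0..c} \<and> F_fun chi (Suc i) d = d"
        using d by simp
    qed (use uniq in blast)
    have "d \<in> {pmf chi 0..1}"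
      using pgf_bounds[OF arg[of d], of chi] d by simp
    moreover have "continuous_on {0..d} (F_fun chi (Suc i))"
      by (rule continuous_on_subset[OF contS]) (use d in auto)
    ultimately show ?thesis
      unfolding inv_def c_Suc c_def[symmetric] monotone_on_def
      using d antiS by (auto simp del: F_fun.simps)
  qed
  have inv: "inv i" for i
  proof (induction i)
    case 0
    show ?case
      by (auto simp: inv_def pmf_le_1 monotone_on_def continuous_on_const)
  qed (use step in blast)
  show "c_fix chi i \<in> {pmf chi 0..1} \<and> F_fun chi i (c_fix chi i) = c_fix chi i \<and>
      continuous_on {0..c_fix chi i} (F_fun chi i) \<and> antimono_on {0..c_fix chi i} (F_fun chi i)"
    using inv[of i] by (simp add: inv_def)
  show "c_fix chi (Suc i) \<le> c_fix chi i" "antimono_on {0..c_fix chi i} (F_fun chi (Suc i))"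
    using step[OF inv] by auto
qed

lemma c_fix_antimono: "i \<le> j \<Longrightarrow> c_fix chi j \<le> c_fix chi i"
  by (rule lift_Suc_antimono_le[of "c_fix chi"]) (rule c_fix_Suc_le)

lemma c_fix_domain: "Suc i \<le> k \<Longrightarrow> c_fix chi (k - 1) \<le> c_fix chi i"
  by (rule c_fix_antimono) arith

lemma c_fix_nonneg: "0 \<le> c_fix chi i"
  using c_fix_properties[of chi i] order_trans[OF pmf_nonneg[of chi 0]] by auto

text \<open>
  A decreasing function lies below the diagonal to the right of its fixed point. This places
  \<open>nl chi k\<close> in the domain of \<open>H_fun chi k\<close>.
\<close>

lemma le_c_fixI:
  assumes "0 \<le> x" "x \<le> 1" "\<And>i. i \<le> k \<Longrightarrow> x \<le> F_fun chi i x"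
  shows "x \<le> c_fix chi (k - 1)"
proof -
  have "x \<le> c_fix chi i" if "i \<le> k" for i
    using that
  proof (induction i)
    case (Suc i)
    show ?case
    proof (rule ccontr)
      assume less: "\<not> x \<le> c_fix chi (Suc i)"
      have "F_fun chi (Suc i) x \<le> F_fun chi (Suc i) (c_fix chi (Suc i))"
        using less Suc c_fix_nonneg[of chi "Suc i"] assms(1)
        by (intro monotone_onD[OF antimono_F_fun_Suc[of chi i]])
           (auto simp del: F_fun.simps c_fix.simps)
      also have "\<dots> = c_fix chi (Suc i)"
        using c_fix_properties[of chi "Suc i"] by blast
      finally show False
        using less assms(3)[of "Suc i"] Suc.prems by linarith
    qed
  qed (use assms in simp)
  then show ?thesis by simp
qed

lemma F_fun_antimono:
  assumes "0 \<le> x" "x \<le> y" "y \<le> c_fix chi (k - 1)" "i \<le> k"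
  shows "F_fun chi i y \<le> F_fun chi i x"
proof (cases i)
  case (Suc j)
  then have "y \<le> c_fix chi j"
    using assms c_fix_domain[of j k chi] by simp
  then show ?thesis
    using assms antimono_F_fun_Suc[of chi j] unfolding Suc monotone_on_def by auto
qed simp

lemma F_fun_minus_in_unit_interval:
  assumes "x \<in> {0..c_fix chi i}"
  shows "F_fun chi i x - x \<in> {0..1}"
proof -
  have anti: "antimono_on {0..c_fix chi i} (F_fun chi i)"
    and fixed: "F_fun chi i (c_fix chi i) = c_fix chi i"
    using c_fix_properties[of chi i] by auto
  have "F_fun chi i (c_fix chi i) \<le> F_fun chi i x" "F_fun chi i x \<le> F_fun chi i 0"
    using assms c_fix_nonneg[of chi i] by (auto intro: monotone_onD[OF anti])
  then show ?thesis
    using assms by (simp add: fixed F_fun_at_0)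
qed

lemma F_fun_bounds:
  assumes "x \<in> {0..c_fix chi (k - 1)}" "i \<le> k"
  shows "F_fun chi i x \<in> {0..1}"
proof (cases i)
  case (Suc j)
  then have "x \<in> {0..c_fix chi j}"
    using assms c_fix_domain[of j k chi] by simp
  from pgf_bounds[OF F_fun_minus_in_unit_interval[OF this], of chi] show ?thesis
    unfolding Suc using order_trans[OF pmf_nonneg[of chi 0]] by auto
qed simp

lemma F_fun_index_antimono:
  assumes x: "x \<in> {0..c_fix chi (k - 1)}" and "i \<le> j" "j \<le> k"
  shows "F_fun chi j x \<le> F_fun chi i x"
proof -
  have Suc: "F_fun chi (Suc i) x \<le> F_fun chi i x" if "Suc i \<le> k" for i
    using that
  proof (induction i)
    case 0
    then show ?case using F_fun_bounds[OF x, of 1] by simp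
  next
    case (Suc i)
    have "x \<in> {0..c_fix chi i}" "x \<in> {0..c_fix chi (Suc i)}"
      using x Suc c_fix_domain[of i k chi] c_fix_domain[of "Suc i" k chi] by (auto simp del: c_fix.simps)
    from this[THEN F_fun_minus_in_unit_interval] show ?case
      using Suc by (simp add: pgf_mono)
  qed
  show ?thesis
    using assms(2,3) by (induction j rule: dec_induct) (use Suc in force)+
qed


section \<open>Monotonicity of the functions $g_i$\<close>

text \<open>
  On decreasing arguments \<open>g_fun chi\<close> increases with its first argument. This is proved
  together with the range, because it makes the difference in the recursion nonnegative.
\<close>

lemma g_fun_range_and_head_mono:
  assumes "rs \<noteq> []" "sorted_wrt (\<ge>) (s # rs)" "s \<le> t" "set (t # rs) \<subseteq> {0..1}"
  shows "g_dom chi (s # rs) \<and> g_dom chi (t # rs) \<and>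
         0 \<le> g_fun chi (s # rs) \<and> g_fun chi (s # rs) \<le> g_fun chi (t # rs) \<and>
         g_fun chi (t # rs) \<le> 1"
  using assms
proof (induction rs arbitrary: s t)
  case (Cons r rs)
  show ?case
  proof (cases rs)
    case Nil
    then show ?thesis using Cons.prems by auto
  next
    case (Cons r' rs')
    have head: "g_dom chi (a # rs) \<and> g_dom chi (b # rs) \<and>
         0 \<le> g_fun chi (a # rs) \<and> g_fun chi (a # rs) \<le> g_fun chi (b # rs) \<and>
         g_fun chi (b # rs) \<le> 1" if "r \<le> a" "a \<le> b" "b \<le> 1" for a b
      by (rule Cons.IH) (use Cons.prems that Cons in auto)
    note h = head[of r s] head[of r t] head[of s t]
    have "pgf chi (g_fun chi (r # rs)) \<le> pgf chi (g_fun chi (s # rs))"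
      "pgf chi (g_fun chi (s # rs)) \<le> pgf chi (g_fun chi (t # rs))"
      "pgf chi (g_fun chi (t # rs)) \<le> 1" "0 \<le> pgf chi (g_fun chi (r # rs))"
      using h Cons.prems pgf_bounds[of "g_fun chi (t # rs)" chi]
        pgf_bounds[of "g_fun chi (r # rs)" chi] order_trans[OF pmf_nonneg[of chi 0]]
      by (auto intro!: pgf_mono)
    then show ?thesis
      using h Cons.prems unfolding Cons by auto
  qed
qed simp

text \<open>
  The tail enters the recursion both positively and negatively, so that its effect on \<open>g_fun chi\<close>
  alone does not propagate. What propagates by convexity is the stronger fact that lowering the
  tail also enlarges the increments in the first argument.
\<close>

lemma g_fun_tail_antimono:
  assumes "list_all2 (\<le>) rs' rs" "rs \<noteq> []"
    and "sorted_wrt (\<ge>) (s # rs)" "sorted_wrt (\<ge>) rs'" "s \<le> t"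
    and "set (t # rs) \<subseteq> {0..1}" "set rs' \<subseteq> {0..1}"
  shows "g_fun chi (t # rs) - g_fun chi (s # rs) \<le> g_fun chi (t # rs') - g_fun chi (s # rs') \<and>
         g_fun chi (s # rs) \<le> g_fun chi (s # rs')"
  using assms
proof (induction rs arbitrary: rs' s t rule: list.induct)
  case (Cons r rs)
  obtain r' us where rs': "rs' = r' # us" and r': "r' \<le> r" and us: "list_all2 (\<le>) us rs"
    using Cons.prems(1) by (auto simp: list_all2_Cons2)
  show ?case
  proof (cases "rs = []")
    case True
    then show ?thesis using us r' by (simp add: rs')
  next
    case False
    have us_ne: "us \<noteq> []" using us False by auto
    have rec: "g_fun chi (a # r # rs) = pgf chi (g_fun chi (a # rs)) - pgf chi (g_fun chi (r # rs))"
      "g_fun chi (a # rs') = pgf chi (g_fun chi (a # us)) - pgf chi (g_fun chi (r' # us))" for a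
      using False us_ne by (cases rs; cases us; simp add: rs')+
    have inc: "pgf chi (g_fun chi (b # rs)) - pgf chi (g_fun chi (a # rs)) \<le>
               pgf chi (g_fun chi (b # us)) - pgf chi (g_fun chi (a # us))"
      if "r \<le> a" "a \<le> b" "b \<le> 1" for a b
    proof -
      have tail: "g_fun chi (b # rs) - g_fun chi (a # rs) \<le> g_fun chi (b # us) - g_fun chi (a # us) \<and>
         g_fun chi (a # rs) \<le> g_fun chi (a # us)"
        by (rule Cons.IH) (use us False Cons.prems that in \<open>auto simp: rs'\<close>)
      have below: "\<forall>x\<in>set rs. x \<le> a" "\<forall>x\<in>set us. x \<le> a"
        using Cons.prems that r' by (fastforce simp: rs')+
      have bounds: "0 \<le> g_fun chi (a # rs)" "g_fun chi (a # rs) \<le> g_fun chi (b # rs)"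
        using g_fun_range_and_head_mono[of rs a b chi] False below Cons.prems that by auto
      have "g_fun chi (b # us) \<le> 1"
        using g_fun_range_and_head_mono[of us a b chi] us_ne below Cons.prems that by (auto simp: rs')
      then show ?thesis
        using pgf_increment_mono[of "g_fun chi (a # rs)" "g_fun chi (a # us)"
            "g_fun chi (b # rs) - g_fun chi (a # rs)" "g_fun chi (b # us) - g_fun chi (a # us)" chi]
          tail bounds by simp
    qed
    have "0 \<le> g_fun chi (r' # us)" "g_fun chi (r' # us) \<le> g_fun chi (r # us)"
      "g_fun chi (r # us) \<le> 1"
      using g_fun_range_and_head_mono[of us r' r chi] us_ne Cons.prems r' by (auto simp: rs')
    then have "pgf chi (g_fun chi (r' # us)) \<le> pgf chi (g_fun chi (r # us))"
      by (rule pgf_mono)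
    then show ?thesis
      unfolding rec using inc[of s t] inc[of r s] Cons.prems by auto
  qed
qed simp


section \<open>The function $H_k$\<close>

lemma F_list_Cons: "F_list chi k x = 1 # map (\<lambda>i. F_fun chi i x) [1..<Suc k]"
  unfolding F_list_def by (subst upt_conv_Cons) auto

lemma sorted_F_tail:
  assumes "x \<in> {0..c_fix chi (k - 1)}"
  shows "sorted_wrt (\<ge>) (map (\<lambda>i. F_fun chi i x) [1..<Suc k])"
  unfolding sorted_wrt_map
  by (rule sorted_wrt_mono_rel[OF _ sorted_wrt_upt]) (use F_fun_index_antimono[OF assms] in auto)

lemma F_tail_bounds:
  assumes "x \<in> {0..c_fix chi (k - 1)}"
  shows "set (map (\<lambda>i. F_fun chi i x) [1..<Suc k]) \<subseteq> {0..1}"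
  using F_fun_bounds[OF assms] by auto

lemma g_fun_F_list:
  assumes "x \<in> {0..c_fix chi (k - 1)}" "1 \<le> k"
  shows "g_dom chi (F_list chi k x) \<and> g_fun chi (F_list chi k x) \<in> {0..1}"
  using g_fun_range_and_head_mono[of "map (\<lambda>i. F_fun chi i x) [1..<Suc k]" 1 1 chi]
    sorted_F_tail[OF assms(1)] F_tail_bounds[OF assms(1)] assms(2)
  unfolding F_list_Cons by (auto simp: image_subset_iff simp del: upt_Suc)

lemma H_fun_bounds:
  assumes "x \<in> {0..c_fix chi (k - 1)}" "1 \<le> k"
  shows "H_fun chi k x \<in> {pmf chi 0..1}"
  unfolding H_fun_def using g_fun_F_list[OF assms] by (blast intro: pgf_bounds)

text \<open>
  The first entry of the list is the constant \<open>F_fun chi 0 x = 1\<close>, and all the others, which make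
  up the tail, decrease with \<open>x\<close>.
\<close>

lemma H_fun_mono:
  assumes "0 \<le> x" "x \<le> y" "y \<le> c_fix chi (k - 1)" "1 \<le> k"
  shows "H_fun chi k x \<le> H_fun chi k y"
proof -
  have x: "x \<in> {0..c_fix chi (k - 1)}" and y: "y \<in> {0..c_fix chi (k - 1)}"
    using assms by auto
  have "list_all2 (\<le>) (map (\<lambda>i. F_fun chi i y) [1..<Suc k]) (map (\<lambda>i. F_fun chi i x) [1..<Suc k])"
    using F_fun_antimono[OF assms(1-3)] by (auto simp: list_all2_map1 list_all2_map2 list_all2_same)
  then have "g_fun chi (F_list chi k x) \<le> g_fun chi (F_list chi k y)"
    unfolding F_list_Cons
    using g_fun_tail_antimono[of "map (\<lambda>i. F_fun chi i y) [1..<Suc k]"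
        "map (\<lambda>i. F_fun chi i x) [1..<Suc k]" 1 1 chi]
      sorted_F_tail[OF x] F_tail_bounds[OF x] sorted_F_tail[OF y] F_tail_bounds[OF y] assms(4)
    by (auto simp: image_subset_iff simp del: upt_Suc)
  then show ?thesis
    unfolding H_fun_def
    using g_fun_F_list[OF x assms(4)] g_fun_F_list[OF y assms(4)] by (auto intro: pgf_mono)
qed


section \<open>Winning strategies and losing positions\<close>

text \<open>
  The positions from which the player to move loses within at most \<open>n - 1\<close> rounds, a round
  being a pair of moves.
\<close>

primrec lost_within :: "('v \<Rightarrow> 'v set) \<Rightarrow> nat \<Rightarrow> 'v set" where
  "lost_within M 0 = {}"
| "lost_within M (Suc n) = {u. \<forall>v\<in>M u. \<exists>w\<in>M v. w \<in> lost_within M n}"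

definition losing :: "('v \<Rightarrow> 'v set) \<Rightarrow> 'v set" where
  "losing M = (\<Union>n. lost_within M n)"

lemma lost_within_mono: "m \<le> n \<Longrightarrow> lost_within M m \<subseteq> lost_within M n"
proof (rule lift_Suc_mono_le[of "lost_within M"])
  show "lost_within M n \<subseteq> lost_within M (Suc n)" for n
    by (induction n) (simp, fastforce)
qed

text \<open>
  With finitely many moves at each position a bound on the number of rounds can be chosen
  uniformly over the first move, so that nothing new is lost in infinitely many rounds.
\<close>

lemma losing_iff:
  assumes "finite (M u)"
  shows "u \<in> losing M \<longleftrightarrow> (\<forall>v\<in>M u. \<exists>w\<in>M v. w \<in> losing M)"
proof
  assume "u \<in> losing M"
  then obtain n where "u \<in> lost_within M n"
    by (auto simp: losing_def)
  then have "u \<in> lost_within M (Suc n)"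
    using lost_within_mono[of n "Suc n" M] by auto
  then show "\<forall>v\<in>M u. \<exists>w\<in>M v. w \<in> losing M"
    unfolding losing_def lost_within.simps by blast
next
  assume "\<forall>v\<in>M u. \<exists>w\<in>M v. w \<in> losing M"
  then have "\<forall>v\<in>M u. \<exists>n. \<exists>w\<in>M v. w \<in> lost_within M n"
    by (fastforce simp: losing_def)
  then obtain b where b: "\<forall>v\<in>M u. \<exists>w\<in>M v. w \<in> lost_within M (b v)"
    by metis
  define n where "n = Max (b ` M u)"
  have "\<exists>w\<in>M v. w \<in> lost_within M n" if "v \<in> M u" for v
  proof -
    have "b v \<le> n"
      unfolding n_def using that assms by simp
    then show ?thesis
      using b that lost_within_mono[of "b v" n M] by blast
  qed
  then have "u \<in> lost_within M (Suc n)"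
    by simp
  then show "u \<in> losing M"
    unfolding losing_def by blast
qed

text \<open>
  Always moving to a losing position would not be enough for a win, since the play might go on
  forever; so the strategy moves to one that is lost in the fewest rounds.
\<close>

definition winning_move :: "('v \<Rightarrow> 'v set) \<Rightarrow> 'v \<Rightarrow> 'v" where
  "winning_move M v =
     (if M v \<inter> losing M = {} then SOME w. w \<in> M v
      else SOME w. w \<in> M v \<and> (\<exists>n. w \<in> lost_within M n \<and> M v \<inter> lost_within M (n - 1) = {}))"

lemma
  assumes "M v \<noteq> {}"
  shows winning_move_legal: "winning_move M v \<in> M v"
    and winning_move_fastest: "M v \<inter> lost_within M n \<noteq> {} \<Longrightarrow> winning_move M v \<in> lost_within M n"
proof -
  have *: "winning_move M v \<in> M v \<and>
      (\<forall>n. M v \<inter> lost_within M n \<noteq> {} \<longrightarrow> winning_move M v \<in> lost_within M n)"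
  proof (cases "M v \<inter> losing M = {}")
    case True
    then have "M v \<inter> lost_within M n = {}" for n
      by (auto simp: losing_def)
    then show ?thesis
      using assms True by (auto simp: winning_move_def some_in_eq)
  next
    case False
    define n where "n = (LEAST n. M v \<inter> lost_within M n \<noteq> {})"
    have ex: "\<exists>n. M v \<inter> lost_within M n \<noteq> {}"
      using False by (auto simp: losing_def)
    have n: "M v \<inter> lost_within M n \<noteq> {}"
      unfolding n_def using ex by (rule LeastI_ex)
    have less: "M v \<inter> lost_within M m = {}" if "m < n" for m
      using not_less_Least[OF that[unfolded n_def]] by simp
    have "n \<noteq> 0"
      using n by (cases n) auto
    then have "M v \<inter> lost_within M (n - 1) = {}"
      using less[of "n - 1"] by simp
    with n have "\<exists>w. w \<in> M v \<and> (\<exists>n. w \<in> lost_within M n \<and> M v \<inter> lost_within M (n - 1) = {})"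
      by blast
    from someI_ex[OF this] False obtain m where m: "winning_move M v \<in> M v"
      "winning_move M v \<in> lost_within M m" "M v \<inter> lost_within M (m - 1) = {}"
      by (auto simp: winning_move_def)
    have "winning_move M v \<in> lost_within M l" if "M v \<inter> lost_within M l \<noteq> {}" for l
    proof -
      have "m \<le> l"
      proof (rule ccontr)
        assume "\<not> m \<le> l"
        then have "lost_within M l \<subseteq> lost_within M (m - 1)"
          by (intro lost_within_mono) simp
        then show False using m that by blast
      qed
      then show ?thesis using m lost_within_mono[of m l M] by blast
    qed
    then show ?thesis using m by blast
  qed
  then show "winning_move M v \<in> M v"
    and "M v \<inter> lost_within M n \<noteq> {} \<Longrightarrow> winning_move M v \<in> lost_within M n"
    by auto
qed

lemma mover_Suc: "mover (Suc i) = p \<longleftrightarrow> mover i \<noteq> p"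
  by (cases p) (auto simp: mover_def)

text \<open>
  Once the opponent has to move from a losing position, each further round lowers the number of
  rounds that the opponent can survive.
\<close>

lemma winning_move_wins:
  assumes "complete_play M v n x" "follows p (\<lambda>h. winning_move M (last h)) n x"
    and "enat i \<le> n" "mover i \<noteq> p" "x i \<in> lost_within M r"
  shows "won_by p n"
  using assms(3-5)
proof (induction r arbitrary: i)
  case (Suc r)
  show ?case
  proof (cases "n = enat i")
    case True
    then show ?thesis using Suc.prems by (auto simp: won_by_def)
  next
    case False
    with Suc.prems have i: "enat i < n" by simp
    then have "x (Suc i) \<in> M (x i)"
      using assms(1) by (auto simp: complete_play_def)
    then have W: "M (x (Suc i)) \<inter> lost_within M r \<noteq> {}"
      using Suc.prems by auto
    then have "n \<noteq> enat (Suc i)"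
      using assms(1) by (auto simp: complete_play_def)
    with i have Si: "enat (Suc i) < n"
      by (metis Suc_ile_eq order_le_less)
    have "mover (Suc i) = p"
      using Suc.prems by (simp add: mover_Suc)
    then have "x (Suc (Suc i)) = winning_move M (x (Suc i))"
      using assms(2) Si by (auto simp: follows_def)
    then have "x (Suc (Suc i)) \<in> lost_within M r"
      using W winning_move_fastest[of M "x (Suc i)" r] by auto
    moreover have "enat (Suc (Suc i)) \<le> n"
      using Si by (simp add: Suc_ile_eq)
    moreover have "mover (Suc (Suc i)) \<noteq> p"
      using Suc.prems by (simp add: mover_Suc)
    ultimately show ?thesis using Suc.IH by blast
  qed
qed simp

lemma is_strategy_winning_move: "is_strategy M (\<lambda>h. winning_move M (last h))"
  by (simp add: is_strategy_def winning_move_legal)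

text \<open>
  A play in which the opponent of \<open>p\<close> answers the strategy \<open>\<sigma>\<close> by the positional strategy \<open>\<tau>\<close>,
  given by its list of positions; it is continued even when there is no legal move.
\<close>

primrec history :: "player \<Rightarrow> ('v list \<Rightarrow> 'v) \<Rightarrow> ('v \<Rightarrow> 'v) \<Rightarrow> 'v \<Rightarrow> nat \<Rightarrow> 'v list" where
  "history p \<sigma> \<tau> v 0 = [v]"
| "history p \<sigma> \<tau> v (Suc i) = history p \<sigma> \<tau> v i @
     [if mover i = p then \<sigma> (history p \<sigma> \<tau> v i) else \<tau> (last (history p \<sigma> \<tau> v i))]"

lemma history_eq_map: "history p \<sigma> \<tau> v i = map (\<lambda>j. last (history p \<sigma> \<tau> v j)) [0..<Suc i]"
proof (induction i)
  case (Suc i)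
  have "history p \<sigma> \<tau> v (Suc i) = history p \<sigma> \<tau> v i @ [last (history p \<sigma> \<tau> v (Suc i))]"
    by simp
  also have "\<dots> = map (\<lambda>j. last (history p \<sigma> \<tau> v j)) [0..<Suc i] @ [last (history p \<sigma> \<tau> v (Suc i))]"
    by (subst Suc.IH) (rule refl)
  finally show ?case by simp
qed simp

text \<open>
  The opponent of \<open>p\<close> can forever move from positions that are not losing to positions that are
  not winning; \<open>p\<close> has to leave the latter for positions that are not losing, and if the play
  ends, then it does so at a losing position, that is, on the turn of \<open>p\<close>.
\<close>

lemma no_winning_strategy:
  assumes fin: "\<And>u. finite (M u)"
    and start: "if mover 0 = p then M v \<inter> losing M = {} else v \<notin> losing M"
  shows "\<not> has_winning_strategy M v p"
proof
  assume "has_winning_strategy M v p"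
  then obtain \<sigma> where \<sigma>: "is_strategy M \<sigma>"
    and wins: "\<And>n x. complete_play M v n x \<Longrightarrow> follows p \<sigma> n x \<Longrightarrow> won_by p n"
    unfolding has_winning_strategy_def by blast
  define \<tau> where "\<tau> u = (SOME w. w \<in> M u \<and> M w \<inter> losing M = {})" for u
  have \<tau>: "\<tau> u \<in> M u \<and> M (\<tau> u) \<inter> losing M = {}" if "u \<notin> losing M" for u
    unfolding \<tau>_def by (rule someI_ex) (use that losing_iff[of M u, OF fin] in \<open>auto simp: disjoint_iff\<close>)
  define x where "x i = last (history p \<sigma> \<tau> v i)" for i
  have hist: "history p \<sigma> \<tau> v i = map x [0..<Suc i]" for i
    unfolding x_def by (rule history_eq_map)
  have x_0: "x 0 = v"
    by (simp add: x_def)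
  have x_Suc: "x (Suc i) = (if mover i = p then \<sigma> (map x [0..<Suc i]) else \<tau> (x i))" for i
    unfolding x_def[of "Suc i"] by (simp add: hist del: upt_Suc) (simp add: x_def)
  define stuck where "stuck i \<longleftrightarrow> M (x i) = {}" for i
  have last_map_upt_x: "map x [0..<Suc i] \<noteq> [] \<and> last (map x [0..<Suc i]) = x i" for i
    by simp
  have step: "x (Suc i) \<in> M (x i)"
    if "\<not> stuck i" "if mover i = p then M (x i) \<inter> losing M = {} else x i \<notin> losing M" for i
  proof (cases "mover i = p")
    case True
    have "\<sigma> (map x [0..<Suc i]) \<in> M (last (map x [0..<Suc i]))"
      using \<sigma> that(1) unfolding is_strategy_def stuck_def by (metis last_map_upt_x)
    then show ?thesis using True by (simp add: x_Suc)
  qed (use that \<tau> x_Suc in auto)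
  have safe: "if mover i = p then M (x i) \<inter> losing M = {} else x i \<notin> losing M"
    if "\<And>j. j < i \<Longrightarrow> \<not> stuck j" for i
    using that
  proof (induction i)
    case 0
    then show ?case using start by (simp add: x_0)
  next
    case (Suc i)
    then have IH: "if mover i = p then M (x i) \<inter> losing M = {} else x i \<notin> losing M"
      by simp
    have mv: "x (Suc i) \<in> M (x i)"
      using IH Suc.prems by (intro step) auto
    show ?case
    proof (cases "mover i = p")
      case True
      then show ?thesis using IH mv mover_Suc[of i p] by auto
    next
      case False
      then have "M (x (Suc i)) \<inter> losing M = {}"
        using IH \<tau>[of "x i"] by (simp add: x_Suc)
      then show ?thesis using False mover_Suc[of i p] by simp
    qed
  qed
  have follows: "follows p \<sigma> n x" for n
    by (simp add: follows_def x_Suc del: upt_Suc)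
  show False
  proof (cases "\<exists>i. stuck i")
    case True
    define m where "m = (LEAST i. stuck i)"
    have m: "stuck m"
      unfolding m_def using True by (rule LeastI_ex)
    have before: "\<not> stuck j" if "j < m" for j
      using not_less_Least that unfolding m_def by blast
    have "x (Suc i) \<in> M (x i)" if "i < m" for i
      using that before by (intro step safe) auto
    then have "complete_play M v (enat m) x"
      using m by (auto simp: complete_play_def x_0 stuck_def)
    then have "mover m \<noteq> p"
      using wins[OF _ follows] by (auto simp: won_by_def)
    then have "x m \<notin> losing M"
      using safe[of m] before by auto
    moreover have "x m \<in> losing M"
      using m losing_iff[where M = M, OF fin, of "x m"] by (auto simp: stuck_def)
    ultimately show False by blast
  next
    case False
    then have "x (Suc i) \<in> M (x i)" for i
      by (intro step safe) auto
    then have "complete_play M v \<infinity> x"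
      by (auto simp: complete_play_def x_0)
    then show False
      using wins[OF _ follows] by (auto simp: won_by_def)
  qed
qed

lemma P2_wins_iff:
  assumes fin: "\<And>u. finite (M u)"
  shows "has_winning_strategy M v P2 \<longleftrightarrow> v \<in> losing M"
proof
  assume "v \<in> losing M"
  then obtain r where r: "v \<in> lost_within M r"
    by (auto simp: losing_def)
  have "won_by P2 n"
    if "complete_play M v n x" "follows P2 (\<lambda>h. winning_move M (last h)) n x" for n x
    using winning_move_wins[OF that, of 0 r] that(1) r
    by (auto simp: complete_play_def mover_def zero_enat_def[symmetric])
  then show "has_winning_strategy M v P2"
    unfolding has_winning_strategy_def using is_strategy_winning_move by blast
qed (use no_winning_strategy[where M = M and p = P2 and v = v, OF fin] in \<open>auto simp: mover_def\<close>)

lemma P1_wins_iff: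
  assumes fin: "\<And>u. finite (M u)"
  shows "has_winning_strategy M v P1 \<longleftrightarrow> M v \<inter> losing M \<noteq> {}"
proof
  assume "M v \<inter> losing M \<noteq> {}"
  then obtain r where r: "M v \<inter> lost_within M r \<noteq> {}"
    by (auto simp: losing_def)
  have "won_by P1 n"
    if "complete_play M v n x" "follows P1 (\<lambda>h. winning_move M (last h)) n x" for n x
  proof -
    have x: "x 0 = v" and "n \<noteq> 0"
      using that(1) r by (auto simp: complete_play_def zero_enat_def)
    then have n: "0 < n"
      by simp
    then have "x 1 = winning_move M v"
      using that(2) by (force simp: follows_def mover_def zero_enat_def[symmetric] x)
    then have "x 1 \<in> lost_within M r"
      using winning_move_fastest[of M v r] r by auto
    moreover have "enat 1 \<le> n"
      using n by (simp add: one_enat_def[symmetric] ileI1 eSuc_def zero_enat_def Suc_ile_eq)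
    ultimately show ?thesis
      using winning_move_wins[OF that, of 1 r] by (auto simp: mover_def)
  qed
  then show "has_winning_strategy M v P1"
    unfolding has_winning_strategy_def using is_strategy_winning_move by blast
next
  show "has_winning_strategy M v P1 \<Longrightarrow> M v \<inter> losing M \<noteq> {}"
    using no_winning_strategy[where M = M and p = P1 and v = v, OF fin] by (auto simp: mover_def)
qed


section \<open>The branching property of Galton-Watson trees\<close>

definition subtree :: "(nat list \<Rightarrow> nat) \<Rightarrow> nat list \<Rightarrow> nat list \<Rightarrow> nat" where
  "subtree N v = (\<lambda>u. N (v @ u))"

definition all_children :: "(nat list \<Rightarrow> nat) set \<Rightarrow> (nat list \<Rightarrow> nat) set" where
  "all_children E = {N. \<forall>j<N []. subtree N [j] \<in> E}"

lemma space_galton_watson: "space (galton_watson chi) = UNIV"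
  by (simp add: galton_watson_def space_PiM)

lemma prob_space_galton_watson: "prob_space (galton_watson chi)"
  unfolding galton_watson_def by (rule prob_space_PiM) (rule measure_pmf.prob_space_axioms)

lemma measurable_subtree: "(\<lambda>N. subtree N v) \<in> measurable (galton_watson chi) (galton_watson chi)"
  unfolding galton_watson_def subtree_def
  by (rule measurable_PiM_single') (auto simp: space_PiM)

lemma root_degree_distribution:
  "measure (galton_watson chi) {N. N [] = m} = pmf chi m"
proof -
  have "measure (distr (galton_watson chi) (measure_pmf chi) (\<lambda>N. N [])) {m} = pmf chi m"
    unfolding galton_watson_def
    by (subst distr_PiM_component) (auto simp: measure_pmf.prob_space_axioms pmf.rep_eq)
  then show ?thesis
    by (subst (asm) measure_distr)
       (auto simp: galton_watson_def space_PiM vimage_def)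
qed

lemma subtree_distribution:
  assumes "E \<in> sets (galton_watson chi)"
  shows "measure (galton_watson chi) {N. subtree N v \<in> E} = measure (galton_watson chi) E"
proof -
  have "distr (galton_watson chi) (galton_watson chi) (\<lambda>N. subtree N v) = galton_watson chi"
    using distr_PiM_reindex[of "UNIV :: nat list set" "\<lambda>_. measure_pmf chi" "\<lambda>u. v @ u" UNIV]
    by (simp add: galton_watson_def subtree_def measure_pmf.prob_space_axioms inj_on_def
        restrict_def)
  then have "measure (galton_watson chi) E =
      measure (distr (galton_watson chi) (galton_watson chi) (\<lambda>N. subtree N v)) E"
    by simp
  also have "\<dots> = measure (galton_watson chi) {N. subtree N v \<in> E}"
    by (subst measure_distr[OF measurable_subtree assms])
       (simp add: space_galton_watson vimage_def)
  finally show ?thesis ..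
qed

lemma sets_root_degree: "{N. N [] = m} \<in> sets (galton_watson chi)"
  using measurable_sets[of "\<lambda>N. N []" "galton_watson chi" "measure_pmf chi" "{m}"]
  by (simp add: galton_watson_def space_PiM vimage_def)

lemma sets_subtree:
  assumes "E \<in> sets (galton_watson chi)"
  shows "{N. subtree N v \<in> E} \<in> sets (galton_watson chi)"
  using measurable_sets[OF measurable_subtree assms]
  by (simp add: space_galton_watson vimage_def)

text \<open>
  The degree of the root and the subtrees at \<open>[0]\<close>, ..., \<open>[m - 1]\<close> depend on disjoint sets of
  coordinates.
\<close>

lemma prob_root_degree_and_subtrees:
  assumes E: "E \<in> sets (galton_watson chi)"
  shows "measure (galton_watson chi) {N. N [] = m \<and> (\<forall>j<m. subtree N [j] \<in> E)} =
         pmf chi m * measure (galton_watson chi) E ^ m"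
proof -
  let ?M = "galton_watson chi"
  interpret prob_space ?M by (rule prob_space_galton_watson)
  define K where "K i = (case i of None \<Rightarrow> {[]} | Some j \<Rightarrow> range ((#) j))" for i :: "nat option"
  define X where "X i N = restrict N (K i)" for i and N :: "nat list \<Rightarrow> nat"
  define A where "A i = (case i of
      None \<Rightarrow> {f \<in> space (PiM (K i) (\<lambda>_. measure_pmf chi)). f [] = m}
    | Some j \<Rightarrow> {f \<in> space (PiM (K i) (\<lambda>_. measure_pmf chi)). (\<lambda>u. f (j # u)) \<in> E})" for i
  have "indep_vars (\<lambda>_. measure_pmf chi) (\<lambda>u N. N u) UNIV"
  proof (subst indep_vars_iff_distr_eq_PiM')
    have "distr ?M (\<Pi>\<^sub>M u\<in>UNIV. measure_pmf chi) (\<lambda>N. N) = ?M"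
      unfolding galton_watson_def by (rule distr_id)
    moreover have "distr ?M (measure_pmf chi) (\<lambda>N. N u) = measure_pmf chi" for u
      unfolding galton_watson_def
      by (rule distr_PiM_component) (auto simp: measure_pmf.prob_space_axioms)
    ultimately show "distr ?M (\<Pi>\<^sub>M u\<in>UNIV. measure_pmf chi) (\<lambda>N. \<lambda>u\<in>UNIV. N u) =
        (\<Pi>\<^sub>M u\<in>UNIV. distr ?M (measure_pmf chi) (\<lambda>N. N u))"
      by (simp add: restrict_UNIV galton_watson_def[symmetric])
  qed (auto simp: galton_watson_def)
  moreover have "disjoint_family_on K UNIV"
    by (auto simp: K_def disjoint_family_on_def split: option.splits)
  ultimately have indep: "indep_vars (\<lambda>i. PiM (K i) (\<lambda>_. measure_pmf chi)) X UNIV"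
    using indep_vars_restrict[of "\<lambda>_. measure_pmf chi" "\<lambda>u N. N u" UNIV UNIV K]
    by (simp add: X_def[abs_def])
  have A: "A i \<in> sets (PiM (K i) (\<lambda>_. measure_pmf chi))" for i
  proof (cases i)
    case None
    have "(\<lambda>f. f []) \<in> measurable (PiM (K i) (\<lambda>_. measure_pmf chi)) (measure_pmf chi)"
      by (rule measurable_component_singleton) (simp add: K_def None)
    from measurable_sets[OF this, of "{m}"] show ?thesis
      by (simp add: A_def None vimage_def Int_def conj_commute)
  next
    case (Some j)
    have "(\<lambda>f u. f (j # u)) \<in> measurable (PiM (K i) (\<lambda>_. measure_pmf chi)) ?M"
      unfolding galton_watson_def
      by (rule measurable_PiM_single')
         (auto simp: space_PiM K_def Some intro!: measurable_component_singleton)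
    from measurable_sets[OF this E] show ?thesis
      by (simp add: A_def Some vimage_def Int_def conj_commute)
  qed
  have vimage_None: "X None -` A None \<inter> space ?M = {N. N [] = m}"
    by (auto simp: X_def A_def K_def space_PiM space_galton_watson)
  have vimage_Some: "X (Some j) -` A (Some j) \<inter> space ?M = {N. subtree N [j] \<in> E}" for j
    by (auto simp: X_def A_def K_def space_PiM space_galton_watson subtree_def)
  let ?J = "insert None (Some ` {..<m})"
  have "{N. N [] = m \<and> (\<forall>j<m. subtree N [j] \<in> E)} = (\<Inter>i\<in>?J. X i -` A i \<inter> space ?M)"
    by (subst image_insert, subst image_image) (auto simp only: vimage_None vimage_Some Inter_insert
        Int_iff INT_iff mem_Collect_eq lessThan_iff)
  also have "prob \<dots> = (\<Prod>i\<in>?J. prob (X i -` A i \<inter> space ?M))"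
    by (rule indep_varsD[OF indep]) (use A in auto)
  also have "\<dots> = prob {N. N [] = m} * (\<Prod>j<m. prob {N. subtree N [j] \<in> E})"
    by (subst prod.insert) (auto simp: vimage_None vimage_Some prod.reindex)
  also have "\<dots> = pmf chi m * prob E ^ m"
    by (simp add: root_degree_distribution subtree_distribution[OF E])
  finally show ?thesis .
qed

lemma all_children_eq_UN:
  "all_children E = (\<Union>m. {N. N [] = m \<and> (\<forall>j<m. subtree N [j] \<in> E)})"
  by (auto simp: all_children_def)

lemma sets_root_degree_and_subtrees:
  assumes "E \<in> sets (galton_watson chi)"
  shows "{N. N [] = m \<and> (\<forall>j<m. subtree N [j] \<in> E)} \<in> sets (galton_watson chi)"
proof -
  have "{N. N [] = m \<and> (\<forall>j<m. subtree N [j] \<in> E)} =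
        {N. N [] = m} \<inter> (\<Inter>j\<in>{..<m}. {N. subtree N [j] \<in> E})"
    by auto
  also have "\<dots> \<in> sets (galton_watson chi)"
  proof (cases "m = 0")
    case False
    then show ?thesis
      by (intro sets.Int sets_root_degree sets.finite_INT sets_subtree assms) auto
  qed (simp add: sets_root_degree)
  finally show ?thesis .
qed

lemma sets_all_children:
  assumes "E \<in> sets (galton_watson chi)"
  shows "all_children E \<in> sets (galton_watson chi)"
  unfolding all_children_eq_UN
  by (intro sets.countable_UN image_subsetI sets_root_degree_and_subtrees assms)

lemma prob_all_children:
  assumes E: "E \<in> sets (galton_watson chi)"
  shows "measure (galton_watson chi) (all_children E) = pgf chi (measure (galton_watson chi) E)"
proof -
  interpret prob_space "galton_watson chi" by (rule prob_space_galton_watson)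
  have "(\<lambda>m. prob {N. N [] = m \<and> (\<forall>j<m. subtree N [j] \<in> E)}) sums prob (all_children E)"
    unfolding all_children_eq_UN
    by (rule finite_measure_UNION)
       (use sets_root_degree_and_subtrees[OF E] in \<open>auto simp: disjoint_family_on_def\<close>)
  then show ?thesis
    unfolding pgf_def prob_root_degree_and_subtrees[OF E] by (rule sums_unique)
qed


section \<open>Avoiding a class of trees near the root\<close>

lemma subtree_Nil: "subtree N [] = N"
  by (simp add: subtree_def)

lemma subtree_subtree: "subtree (subtree N v) w = subtree N (v @ w)"
  by (simp add: subtree_def)

lemma Nil_in_tree: "[] \<in> tree N"
  by (simp add: tree_def)

lemma append_in_tree_iff: "v @ u \<in> tree N \<longleftrightarrow> v \<in> tree N \<and> u \<in> tree (subtree N v)"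
proof -
  have "(\<forall>j<length v + length u. P j) \<longleftrightarrow>
        (\<forall>j<length v. P j) \<and> (\<forall>j<length u. P (length v + j))" (is "?all = ?split") for P
  proof
    assume ?split
    show ?all
    proof (intro allI impI)
      show "P j" if "j < length v + length u" for j
        using \<open>?split\<close> that by (cases "j < length v") (auto dest: spec[of _ "j - length v"])
    qed
  qed auto
  then show ?thesis
    by (simp add: tree_def subtree_def nth_append)
qed

lemma Cons_in_tree_iff: "j # u \<in> tree N \<longleftrightarrow> j < N [] \<and> u \<in> tree (subtree N [j])"
  using append_in_tree_iff[of "[j]" u N] by (simp add: tree_def)

lemma \<Gamma>_root: "\<Gamma> N a [] = {v \<in> tree N. v \<noteq> [] \<and> length v \<le> a}"
  by (auto simp: \<Gamma>_def strict_prefix_def)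

lemma \<Gamma>_root_Suc:
  "\<Gamma> N (Suc a) [] = (\<Union>j<N []. insert [j] ((#) j ` \<Gamma> (subtree N [j]) a []))"
proof (intro set_eqI)
  show "v \<in> \<Gamma> N (Suc a) [] \<longleftrightarrow> v \<in> (\<Union>j<N []. insert [j] ((#) j ` \<Gamma> (subtree N [j]) a []))" for v
    by (cases v) (auto simp: \<Gamma>_root Cons_in_tree_iff Nil_in_tree)
qed

lemma \<Gamma>_eq_image_\<Gamma>_root:
  assumes "v \<in> tree N"
  shows "\<Gamma> N a v = (@) v ` \<Gamma> (subtree N v) a []"
  using assms by (auto simp: \<Gamma>_def \<Gamma>_root strict_prefix_def append_in_tree_iff prefix_def image_iff)

lemma finite_\<Gamma>: "finite (\<Gamma> N a v)"
proof -
  have root: "finite (\<Gamma> N a [])" for N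
    by (induction a arbitrary: N) (auto simp: \<Gamma>_root_Suc, simp add: \<Gamma>_root)
  show ?thesis
  proof (cases "v \<in> tree N")
    case True
    then show ?thesis by (simp add: \<Gamma>_eq_image_\<Gamma>_root root)
  next
    case False
    then have "\<Gamma> N a v = {}"
      by (auto simp: \<Gamma>_def strict_prefix_def prefix_def append_in_tree_iff)
    then show ?thesis by simp
  qed
qed

text \<open>
  For the class \<open>X\<close> of trees whose root is losing, \<open>avoiding X a\<close> is the event that no losing
  position can be reached from the root by a jump of length at most \<open>a\<close>.
\<close>

definition avoiding :: "(nat list \<Rightarrow> nat) set \<Rightarrow> nat \<Rightarrow> (nat list \<Rightarrow> nat) set" where
  "avoiding X a = {N. \<forall>v\<in>\<Gamma> N a []. subtree N v \<notin> X}"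

lemma avoiding_0: "avoiding X 0 = UNIV"
  by (auto simp: avoiding_def \<Gamma>_root)

lemma avoiding_Suc: "avoiding X (Suc a) = all_children (avoiding X a - X)"
  by (auto simp: avoiding_def \<Gamma>_root_Suc all_children_def subtree_subtree)

lemma avoiding_antimono: "a \<le> b \<Longrightarrow> avoiding X b \<subseteq> avoiding X a"
  by (auto simp: avoiding_def \<Gamma>_root)

lemma avoiding_antimono_class: "X \<subseteq> Y \<Longrightarrow> avoiding Y a \<subseteq> avoiding X a"
  by (auto simp: avoiding_def)

lemma subtree_in_avoiding_iff:
  assumes "v \<in> tree N"
  shows "subtree N v \<in> avoiding X a \<longleftrightarrow> (\<forall>w\<in>\<Gamma> N a v. subtree N w \<notin> X)"
  by (simp add: avoiding_def \<Gamma>_eq_image_\<Gamma>_root[OF assms] subtree_subtree)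

lemma sets_avoiding:
  assumes "X \<in> sets (galton_watson chi)"
  shows "avoiding X a \<in> sets (galton_watson chi)"
proof (induction a)
  case 0
  show ?case
    using sets.top[of "galton_watson chi"] by (simp add: avoiding_0 space_galton_watson)
next
  case (Suc a)
  then show ?case
    unfolding avoiding_Suc by (intro sets_all_children sets.Diff assms)
qed


section \<open>The recursion for the probability of losing\<close>

text \<open>
  The hypothesis on \<open>X\<close> says that no losing position can be reached from a losing one. It turns
  the probability of the difference in the recursion for \<open>avoiding\<close> into a difference of
  probabilities, which yields the recursion for $F_i$.
\<close>

lemma prob_avoiding:
  assumes X: "X \<in> sets (galton_watson chi)" "X \<subseteq> avoiding X k" and "a \<le> k"
  shows "measure (galton_watson chi) (avoiding X a) =
         F_fun chi a (measure (galton_watson chi) X)"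
  using \<open>a \<le> k\<close>
proof (induction a)
  interpret prob_space "galton_watson chi" by (rule prob_space_galton_watson)
  case 0
  show ?case
    using prob_space by (simp add: avoiding_0 space_galton_watson)
next
  interpret prob_space "galton_watson chi" by (rule prob_space_galton_watson)
  case (Suc a)
  then have "X \<subseteq> avoiding X a"
    using X(2) avoiding_antimono[of a k X] by auto
  then show ?case
    using Suc X(1)
    by (simp add: avoiding_Suc prob_all_children sets_avoiding sets.Diff finite_measure_Diff)
qed

text \<open>
  Here \<open>Y\<close> is the event that the root is not winning. The trees counted are those in which the root
  is winning, as is each position at distance at most \<open>i\<close> below it, and the nearest losing
  position below the root is farther than \<open>a\<close>. Passing to the children lowers \<open>i\<close> and \<open>a\<close> by
  one; the bound \<open>k\<close> on the distance of the nearest losing position is expressed by the difference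
  of two such events, and becomes \<open>k - 1\<close>. This is the recursion for the $g_i$.
\<close>

lemma prob_winning_and_avoiding:
  fixes X k
  defines "Y \<equiv> avoiding X k"
  assumes X: "X \<in> sets (galton_watson chi)" "X \<subseteq> Y" and "i \<le> a" "a \<le> k" "i < k"
  shows "measure (galton_watson chi) (avoiding X a \<inter> avoiding Y i - Y) =
         g_fun chi (map (\<lambda>j. F_fun chi j (measure (galton_watson chi) X))
                      ((a - i) # [k - i..<Suc k]))"
  using \<open>i \<le> a\<close> \<open>a \<le> k\<close> \<open>i < k\<close>
proof (induction i arbitrary: a)
  interpret prob_space "galton_watson chi" by (rule prob_space_galton_watson)
  case 0
  have "Y \<subseteq> avoiding X a"
    unfolding Y_def using 0 by (intro avoiding_antimono)
  then show ?case
    using 0 X prob_avoiding[of X chi k]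
    by (simp add: avoiding_0 finite_measure_Diff sets_avoiding Y_def)
next
  interpret prob_space "galton_watson chi" by (rule prob_space_galton_watson)
  case (Suc i)
  obtain b where b: "a = Suc b" using Suc.prems by (cases a) auto
  obtain l where l: "k = Suc l" using Suc.prems by (cases k) auto
  have Y: "Y \<in> sets (galton_watson chi)"
    unfolding Y_def by (intro sets_avoiding X)
  define E where "E c = avoiding X c \<inter> avoiding Y i - Y" for c
  have E: "E c \<in> sets (galton_watson chi)" for c
    unfolding E_def by (intro sets.Diff sets.Int sets_avoiding X Y)
  have "avoiding X (Suc b) \<inter> avoiding Y (Suc i) - avoiding X (Suc l) =
        all_children (E b) - all_children (E l)"
    using X(2) by (auto simp: avoiding_Suc all_children_def E_def)
  then have "prob (avoiding X a \<inter> avoiding Y (Suc i) - Y) =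
      prob (all_children (E b) - all_children (E l))"
    by (simp add: Y_def b l)
  also have "\<dots> = prob (all_children (E b)) - prob (all_children (E l))"
  proof (rule finite_measure_Diff)
    have "E l \<subseteq> E b"
      unfolding E_def using avoiding_antimono[of b l X] Suc.prems b l by auto
    then show "all_children (E l) \<subseteq> all_children (E b)"
      by (auto simp: all_children_def)
  qed (intro sets_all_children E)+
  also have "\<dots> = pgf chi (prob (E b)) - pgf chi (prob (E l))"
    by (simp add: prob_all_children E)
  also have "prob (E b) = g_fun chi (map (\<lambda>j. F_fun chi j (prob X)) ((b - i) # [k - i..<Suc k]))"
    unfolding E_def using Suc.prems by (intro Suc.IH) (auto simp: b)
  also have "prob (E l) = g_fun chi (map (\<lambda>j. F_fun chi j (prob X)) ((l - i) # [k - i..<Suc k]))"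
    unfolding E_def using Suc.prems by (intro Suc.IH) (auto simp: l)
  also have "pgf chi (g_fun chi (map (\<lambda>j. F_fun chi j (prob X)) ((b - i) # [k - i..<Suc k]))) -
      pgf chi (g_fun chi (map (\<lambda>j. F_fun chi j (prob X)) ((l - i) # [k - i..<Suc k]))) =
      g_fun chi (map (\<lambda>j. F_fun chi j (prob X)) ((a - Suc i) # [k - Suc i..<Suc k]))"
  proof -
    have "[k - Suc i..<Suc k] = (l - i) # [k - i..<Suc k]"
      using Suc.prems l by (subst upt_conv_Cons) (auto simp: Suc_diff_le)
    moreover have "[k - i..<Suc k] = (k - i) # [Suc (k - i)..<Suc k]"
      by (subst upt_conv_Cons) auto
    ultimately show ?thesis by (simp add: b del: upt_Suc)
  qed
  finally show ?case .
qed

text \<open>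
  The root is losing if and only if all positions that can be reached from it are winning. In terms
  of the children this means that each child, with all positions down to distance \<open>k - 1\<close> below it, is
  winning; that no losing position is that close is then automatic.
\<close>

lemma prob_avoiding_avoiding:
  assumes X: "X \<in> sets (galton_watson chi)" "X \<subseteq> avoiding X k" and "1 \<le> k"
  shows "measure (galton_watson chi) (avoiding (avoiding X k) k) =
         H_fun chi k (measure (galton_watson chi) X)"
proof -
  obtain l where l: "k = Suc l" using \<open>1 \<le> k\<close> by (cases k) auto
  define Y where "Y = avoiding X k"
  have Y: "Y \<in> sets (galton_watson chi)"
    unfolding Y_def by (intro sets_avoiding X)
  have "avoiding Y l \<subseteq> avoiding X l"
    using X(2) unfolding Y_def by (rule avoiding_antimono_class)
  then have "avoiding Y k = all_children (avoiding X l \<inter> avoiding Y l - Y)"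
    by (simp add: l avoiding_Suc Int_absorb1)
  then have "measure (galton_watson chi) (avoiding Y k) =
      pgf chi (measure (galton_watson chi) (avoiding X l \<inter> avoiding Y l - Y))"
    by (simp add: prob_all_children sets_avoiding X Y sets.Diff sets.Int)
  also have "\<dots> = H_fun chi k (measure (galton_watson chi) X)"
    using prob_winning_and_avoiding[of X chi k l l] X upt_conv_Cons[of 0 "Suc k"]
    by (simp add: H_fun_def F_list_def Y_def l del: upt_Suc)
  finally show ?thesis
    by (simp add: Y_def)
qed

section \<open>Losing trees\<close>

text \<open>
  The counterpart of \<open>lost_within (\<Gamma> N k)\<close> for the root, described by trees instead of positions
  so that it becomes an event: \<open>avoiding X k\<close> is the complement of the event that a move to a
  position with subtree in \<open>X\<close> exists.
\<close>

primrec losing_trees :: "nat \<Rightarrow> nat \<Rightarrow> (nat list \<Rightarrow> nat) set" where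
  "losing_trees k 0 = {}"
| "losing_trees k (Suc n) = avoiding (avoiding (losing_trees k n) k) k"

definition eventually_losing_trees :: "nat \<Rightarrow> (nat list \<Rightarrow> nat) set" where
  "eventually_losing_trees k = (\<Union>n. losing_trees k n)"

lemma \<Gamma>_subset_tree: "w \<in> \<Gamma> N a v \<Longrightarrow> w \<in> tree N"
  by (simp add: \<Gamma>_def)

lemma lost_within_iff_losing_trees:
  "v \<in> tree N \<Longrightarrow> v \<in> lost_within (\<Gamma> N k) n \<longleftrightarrow> subtree N v \<in> losing_trees k n"
proof (induction n arbitrary: v)
  case (Suc n)
  have "subtree N w \<notin> avoiding (losing_trees k n) k \<longleftrightarrow>
      (\<exists>z\<in>\<Gamma> N k w. z \<in> lost_within (\<Gamma> N k) n)" if "w \<in> \<Gamma> N k v" for w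
    using that Suc.IH \<Gamma>_subset_tree by (auto simp: subtree_in_avoiding_iff)
  then show ?case
    using Suc.prems by (simp add: subtree_in_avoiding_iff)
qed simp

lemma losing_iff_eventually_losing_trees:
  "v \<in> tree N \<Longrightarrow> v \<in> losing (\<Gamma> N k) \<longleftrightarrow> subtree N v \<in> eventually_losing_trees k"
  by (simp add: losing_def eventually_losing_trees_def lost_within_iff_losing_trees)

lemma incseq_losing_trees: "incseq (losing_trees k)"
proof (rule incseq_SucI)
  show "losing_trees k n \<subseteq> losing_trees k (Suc n)" for n
  proof (induction n)
    case (Suc n)
    then have "avoiding (avoiding (losing_trees k n) k) k \<subseteq>
        avoiding (avoiding (losing_trees k (Suc n)) k) k"
      by (rule avoiding_antimono_class[OF avoiding_antimono_class])
    then show ?case by simp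
  qed simp
qed

lemma losing_trees_subset_avoiding: "losing_trees k n \<subseteq> avoiding (losing_trees k n) k"
proof (induction n)
  case (Suc n)
  then have "avoiding (avoiding (losing_trees k n) k) k \<subseteq>
      avoiding (avoiding (avoiding (losing_trees k n) k) k) k"
    by (rule avoiding_antimono_class[OF avoiding_antimono_class])
  then show ?case by simp
qed simp

lemma eventually_losing_trees_subset_avoiding:
  "eventually_losing_trees k \<subseteq> avoiding (eventually_losing_trees k) k"
proof
  fix N assume "N \<in> eventually_losing_trees k"
  then obtain n where n: "N \<in> losing_trees k n"
    by (auto simp: eventually_losing_trees_def)
  have False if "v \<in> \<Gamma> N k []" "subtree N v \<in> losing_trees k m" for v m
  proof -
    have "N \<in> losing_trees k (max m n)" "subtree N v \<in> losing_trees k (max m n)"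
      using n that(2) incseqD[OF incseq_losing_trees] by (meson max.cobounded1 max.cobounded2 subsetD)+
    then show False
      using losing_trees_subset_avoiding that(1) by (force simp: avoiding_def)
  qed
  then show "N \<in> avoiding (eventually_losing_trees k) k"
    by (auto simp: avoiding_def eventually_losing_trees_def)
qed

lemma not_in_avoiding_eventually_losing_trees_iff:
  assumes "v \<in> tree N"
  shows "subtree N v \<notin> avoiding (eventually_losing_trees k) k \<longleftrightarrow>
         \<Gamma> N k v \<inter> losing (\<Gamma> N k) \<noteq> {}"
  using assms \<Gamma>_subset_tree
  by (auto simp: subtree_in_avoiding_iff losing_iff_eventually_losing_trees)

lemma eventually_losing_trees_fixed_point:
  "avoiding (avoiding (eventually_losing_trees k) k) k = eventually_losing_trees k"
proof (intro set_eqI)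
  fix N
  have "N \<in> avoiding (avoiding (eventually_losing_trees k) k) k \<longleftrightarrow>
      (\<forall>v\<in>\<Gamma> N k []. \<exists>w\<in>\<Gamma> N k v. w \<in> losing (\<Gamma> N k))"
    using not_in_avoiding_eventually_losing_trees_iff \<Gamma>_subset_tree
    by (fastforce simp: avoiding_def[of "avoiding _ _"])
  also have "\<dots> \<longleftrightarrow> [] \<in> losing (\<Gamma> N k)"
    by (rule losing_iff[symmetric]) (rule finite_\<Gamma>)
  also have "\<dots> \<longleftrightarrow> N \<in> eventually_losing_trees k"
    by (simp add: losing_iff_eventually_losing_trees Nil_in_tree subtree_Nil)
  finally show "N \<in> avoiding (avoiding (eventually_losing_trees k) k) k \<longleftrightarrow>
      N \<in> eventually_losing_trees k" .
qed

lemma sets_losing_trees: "losing_trees k n \<in> sets (galton_watson chi)"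
  by (induction n) (auto intro: sets_avoiding)

lemma sets_eventually_losing_trees: "eventually_losing_trees k \<in> sets (galton_watson chi)"
  unfolding eventually_losing_trees_def by (intro sets.countable_UN image_subsetI sets_losing_trees)


section \<open>The probabilities of losing and winning\<close>

lemma nl_eq_measure: "nl chi k = measure (galton_watson chi) (eventually_losing_trees k)"
  unfolding nl_def
  by (rule arg_cong[where f = "measure _"])
     (auto simp: space_galton_watson P2_wins_iff finite_\<Gamma> losing_iff_eventually_losing_trees
        Nil_in_tree subtree_Nil)

lemma nw_eq_measure:
  "nw chi k = measure (galton_watson chi) (UNIV - avoiding (eventually_losing_trees k) k)"
  unfolding nw_def
  by (rule arg_cong[where f = "measure _"])
     (use not_in_avoiding_eventually_losing_trees_iff[OF Nil_in_tree] in
       \<open>auto simp: space_galton_watson P1_wins_iff finite_\<Gamma> subtree_Nil\<close>)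

lemma nl_fixed_point:
  assumes "1 \<le> k"
  shows "H_fun chi k (nl chi k) = nl chi k"
  using prob_avoiding_avoiding[OF sets_eventually_losing_trees
      eventually_losing_trees_subset_avoiding assms, of chi]
  by (simp add: nl_eq_measure eventually_losing_trees_fixed_point)

text \<open>
  For each \<open>i \<le> k\<close> the losing trees avoid losing positions within distance \<open>i\<close>, which gives
  \<open>nl chi k \<le> F_fun chi i (nl chi k)\<close>.
\<close>

lemma nl_in_domain: "nl chi k \<in> {0..c_fix chi (k - 1)}"
proof -
  interpret prob_space "galton_watson chi" by (rule prob_space_galton_watson)
  have "nl chi k \<le> F_fun chi i (nl chi k)" if "i \<le> k" for i
  proof -
    have "prob (eventually_losing_trees k) \<le> prob (avoiding (eventually_losing_trees k) i)"
      using eventually_losing_trees_subset_avoiding avoiding_antimono[OF that]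
      by (intro finite_measure_mono sets_avoiding sets_eventually_losing_trees) blast
    then show ?thesis
      using prob_avoiding[OF sets_eventually_losing_trees
          eventually_losing_trees_subset_avoiding that]
      by (simp add: nl_eq_measure)
  qed
  then have "nl chi k \<le> c_fix chi (k - 1)"
    by (intro le_c_fixI) (auto simp: nl_eq_measure)
  then show ?thesis
    by (simp add: nl_eq_measure)
qed

text \<open>
  The probabilities of losing within a bounded number of rounds are the iterates of
  \<open>H_fun chi k\<close> started at 0. By monotonicity they stay below each fixed point, and they converge to
  \<open>nl chi k\<close>.
\<close>

lemma nl_le_fixed_point:
  assumes "x \<in> {0..c_fix chi (k - 1)}" "H_fun chi k x = x" "1 \<le> k"
  shows "nl chi k \<le> x"
proof -
  interpret prob_space "galton_watson chi" by (rule prob_space_galton_watson)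
  have "prob (losing_trees k n) \<le> x" for n
  proof (induction n)
    case (Suc n)
    have "prob (losing_trees k (Suc n)) = H_fun chi k (prob (losing_trees k n))"
      using prob_avoiding_avoiding[OF sets_losing_trees losing_trees_subset_avoiding assms(3)]
      by simp
    also have "\<dots> \<le> H_fun chi k x"
      using Suc assms by (intro H_fun_mono) auto
    finally show ?case
      by (simp add: assms(2))
  qed (use assms in simp)
  moreover have "(\<lambda>n. prob (losing_trees k n)) \<longlonglongrightarrow> nl chi k"
    unfolding nl_eq_measure eventually_losing_trees_def
    by (rule finite_Lim_measure_incseq)
       (auto simp: sets_losing_trees incseq_losing_trees)
  ultimately show ?thesis
    by (blast intro: LIMSEQ_le_const2)
qed

lemma nw_eq: "nw chi k = 1 - F_fun chi k (nl chi k)"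
proof -
  interpret prob_space "galton_watson chi" by (rule prob_space_galton_watson)
  show ?thesis
    using prob_compl[OF sets_avoiding[OF sets_eventually_losing_trees[of k]], of k]
      prob_avoiding[where X = "eventually_losing_trees k" and a = k and k = k and chi = chi,
        OF sets_eventually_losing_trees eventually_losing_trees_subset_avoiding]
    by (simp add: nw_eq_measure nl_eq_measure space_galton_watson)
qed

theorem theorem1p1:
  fixes chi :: "nat pmf" and k :: nat
  assumes "0 < pmf chi 0" and "pmf chi 0 < 1" and "1 \<le> k"
  shows "(\<forall>x\<in>{0..c_fix chi (k - 1)}.
            g_dom chi (F_list chi k x) \<and> g_fun chi (F_list chi k x) \<in> {0..1} \<and>
            H_fun chi k x \<in> {0..1}) \<and>
         nl chi k \<in> positive_fixed_points chi k \<and>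
         (\<forall>x\<in>positive_fixed_points chi k. nl chi k \<le> x) \<and>
         nw chi k = 1 - F_fun chi k (nl chi k)"
proof (intro conjI ballI)
  fix x assume x: "x \<in> {0..c_fix chi (k - 1)}"
  show "g_dom chi (F_list chi k x)" "g_fun chi (F_list chi k x) \<in> {0..1}"
    using g_fun_F_list[OF x assms(3)] by auto
  show "H_fun chi k x \<in> {0..1}"
    using H_fun_bounds[OF x assms(3)] assms(1) by auto
next
  have "pmf chi 0 \<le> nl chi k"
    using H_fun_bounds[OF nl_in_domain assms(3), of chi] nl_fixed_point[OF assms(3), of chi] by simp
  then show "nl chi k \<in> positive_fixed_points chi k"
    using assms nl_in_domain[of chi k] nl_fixed_point[OF assms(3), of chi]
    by (auto simp: positive_fixed_points_def)
next
  show "nl chi k \<le> x" if "x \<in> positive_fixed_points chi k" for x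
    using that assms(3) by (auto simp: positive_fixed_points_def intro: nl_le_fixed_point)
next
  show "nw chi k = 1 - F_fun chi k (nl chi k)"
    by (rule nw_eq)
qed

end
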